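(* Let $G$ be an infinite, connected, countable graph such that every vertex has degree at most a constant $D$. For any starting vertex and any initial port, the random basic walk on $G$ cycles with probability $1$.
   Context: Each undirected edge $\{v,w\}$ is regarded as two arcs $v\to w$ and $w\to v$. A labeling assigns, at each vertex $v$ of degree $\deg(v)$, the port numbers $1,\dots,\deg(v)$ bijectively to the arcs leaving $v$ (labels on $v\to w$ and $w\to v$ need not agree). In a random labeling these bijections are chosen uniformly at random, independently for different vertices. Given a labeling, a starting vertex $v_0$ and an initial port $\ell$, the basic walk leaves $v_0$ along the arc labeled $\ell$; thereafter, whenever it enters a vertex $v$ along an arc whose label is $i$, it leaves $v$ along the arc out of $v$ labeled $(i \bmod \deg(v))+1$. The random basic walk is the basic walk for a random labeling. The walk cycles if some arc is traversed twice in the same direction (equivalently, from some point on it is periodic and visits only finitely many vertices); it is transient otherwise. *)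

theory Defs
  imports "HOL-Probability.Probability"
begin

text \<open>A graph is given by an edge relation E on the vertex type 'a
  (symmetric, irreflexive). The neighbours of v are the heads of the arcs leaving v.\<close>

definition nbrs :: "('a \<Rightarrow> 'a \<Rightarrow> bool) \<Rightarrow> 'a \<Rightarrow> 'a set" where
  "nbrs E v = {w. E v w}"

definition deg :: "('a \<Rightarrow> 'a \<Rightarrow> bool) \<Rightarrow> 'a \<Rightarrow> nat" where
  "deg E v = card (nbrs E v)"

text \<open>A labeling is L :: 'a => 'a => nat, where L v w is the port number of the arc v -> w.
  The admissible local labelings at v: a bijection from the arcs leaving v onto
  {1..deg v} (value 0 on non-neighbours, as a canonical default).\<close>

definition local_labelings :: "('a \<Rightarrow> 'a \<Rightarrow> bool) \<Rightarrow> 'a \<Rightarrow> ('a \<Rightarrow> nat) set" where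
  "local_labelings E v =
     {f. bij_betw f (nbrs E v) {1..deg E v} \<and> (\<forall>w. w \<notin> nbrs E v \<longrightarrow> f w = 0)}"

definition random_labeling :: "('a \<Rightarrow> 'a \<Rightarrow> bool) \<Rightarrow> ('a \<Rightarrow> 'a \<Rightarrow> nat) measure" where
  "random_labeling E = PiM UNIV (\<lambda>v. measure_pmf (pmf_of_set (local_labelings E v)))"

text \<open>The basic walk, as its sequence of traversed arcs (u, v) meaning u -> v.
  Arc 0 leaves v0 along the arc labeled l. After traversing arc u -> v, whose label
  is i = L u v, the walk leaves v along the arc out of v labeled (i mod deg v) + 1.\<close>

fun basic_walk :: "('a \<Rightarrow> 'a \<Rightarrow> bool) \<Rightarrow> ('a \<Rightarrow> 'a \<Rightarrow> nat) \<Rightarrow> 'a \<Rightarrow> nat \<Rightarrow> nat \<Rightarrow> 'a \<times> 'a" where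
  "basic_walk E L v0 l 0 = (v0, THE w. E v0 w \<and> L v0 w = l)"
| "basic_walk E L v0 l (Suc n) =
     (let (u, v) = basic_walk E L v0 l n
      in (v, THE w. E v w \<and> L v w = (L u v mod deg E v) + 1))"

definition walk_cycles :: "('a \<Rightarrow> 'a \<Rightarrow> bool) \<Rightarrow> ('a \<Rightarrow> 'a \<Rightarrow> nat) \<Rightarrow> 'a \<Rightarrow> nat \<Rightarrow> bool" where
  "walk_cycles E L v0 l \<longleftrightarrow> (\<exists>m n. m < n \<and> basic_walk E L v0 l m = basic_walk E L v0 l n)"

end

theory Submission
  imports Defs
begin

text \<open>Whatever the walk has seen so far, let it run until it first enters a ball of radius
  \<open>D + 2\<close> that it has not visited. Inside that ball a trap can be laid by choosing the ports of at
  most \<open>2 D + 3\<close> vertices: lead the walk along a geodesic towards the centre to a vertex \<open>x\<close>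
  whose successor \<open>y\<close> has no larger degree, and let it bounce off all neighbours of \<open>x\<close> other than
  \<open>y\<close> and the predecessor \<open>u\<close>. Going on to \<open>y\<close>, it can come back to \<open>x\<close> directly or after
  a detour, and the two returns demand different ports at \<open>x\<close>; only \<open>x \<rightarrow> u\<close> is unused, so one of
  them repeats an arc. The trap has probability bounded below in terms of \<open>D\<close> alone, whatever
  finitely many ports are already known; hence the probability of escaping is \<open>0\<close>.\<close>

declare basic_walk.simps [simp del]

section \<open>Port labelings and the walk they determine\<close>

locale bounded_graph =
  fixes E :: "'a::countable \<Rightarrow> 'a \<Rightarrow> bool" and D :: nat and v0 :: 'a and l :: nat
  assumes sym: "E v w \<Longrightarrow> E w v"
    and irrefl: "\<not> E v v"
    and connected: "E\<^sup>*\<^sup>* v w"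
    and fin_deg: "finite (nbrs E v)"
    and bdd_deg: "deg E v \<le> D"
    and port: "1 \<le> l" "l \<le> deg E v0"
begin

abbreviation walk :: "('a \<Rightarrow> 'a \<Rightarrow> nat) \<Rightarrow> nat \<Rightarrow> 'a \<times> 'a" where
  "walk L n \<equiv> basic_walk E L v0 l n"

text \<open>Points of the product space are arbitrary functions; this is the almost sure event
  (\<open>AE_labeling\<close>) on which the combinatorial arguments apply.\<close>

definition labeling :: "('a \<Rightarrow> 'a \<Rightarrow> nat) \<Rightarrow> bool" where
  "labeling L \<longleftrightarrow> (\<forall>v. L v \<in> local_labelings E v)"

definition next_port :: "'a \<Rightarrow> nat \<Rightarrow> nat" where
  "next_port v i = i mod deg E v + 1"

lemma labeling_inj:
  assumes "labeling L" "E v w" "E v w'" "L v w = L v w'"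
  shows "w = w'"
  using assms unfolding labeling_def local_labelings_def bij_betw_def inj_on_def nbrs_def
  by blast

lemma labeling_range:
  assumes "labeling L" "E v w"
  shows "1 \<le> L v w" "L v w \<le> deg E v"
proof -
  have "L v w \<in> L v ` nbrs E v" using assms(2) by (simp add: nbrs_def)
  also have "\<dots> = {1..deg E v}"
    using assms(1) unfolding labeling_def local_labelings_def bij_betw_def by blast
  finally show "1 \<le> L v w" "L v w \<le> deg E v" by auto
qed

lemma labeling_surj:
  assumes "labeling L" "1 \<le> j" "j \<le> deg E v"
  obtains w where "E v w" "L v w = j"
proof -
  have "j \<in> L v ` nbrs E v"
    using assms unfolding labeling_def local_labelings_def bij_betw_def by auto
  then show ?thesis using that by (auto simp: nbrs_def)
qed

lemma the_arc_eq:
  assumes "labeling L" "E v w" "L v w = j"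
  shows "(THE w. E v w \<and> L v w = j) = w"
  using assms labeling_inj by blast

lemma deg_pos: "E v w \<Longrightarrow> 1 \<le> deg E v"
  using fin_deg[of v] unfolding deg_def by (metis One_nat_def Suc_leI card_gt_0_iff empty_iff mem_Collect_eq nbrs_def)

lemma next_port_range:
  assumes "E v w"
  shows "1 \<le> next_port v i" "next_port v i \<le> deg E v"
  using deg_pos[OF assms] unfolding next_port_def by (auto simp: Suc_le_eq)

lemma walk_0:
  assumes "labeling L"
  obtains w where "walk L 0 = (v0, w)" "E v0 w" "L v0 w = l"
  using labeling_surj[OF assms port] the_arc_eq[OF assms] by (metis basic_walk.simps(1))

lemma walk_Suc_if:
  assumes "labeling L" "walk L n = (u, v)" "E v w" "L v w = next_port v (L u v)"
  shows "walk L (Suc n) = (v, w)"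
  using the_arc_eq[OF assms(1,3,4)] assms(2) by (simp add: next_port_def basic_walk.simps)

lemma walk_edge:
  assumes "labeling L"
  shows "E (fst (walk L n)) (snd (walk L n))"
proof (induction n)
  case 0
  then show ?case using walk_0[OF assms] by (metis fst_conv snd_conv)
next
  case (Suc n)
  obtain u v where uv: "walk L n = (u, v)" by fastforce
  with Suc have "E v u" using sym by simp
  then obtain w where "E v w" "L v w = next_port v (L u v)"
    using labeling_surj[OF assms] next_port_range by metis
  then show ?case using walk_Suc_if[OF assms uv] by simp
qed

lemma walk_SucE:
  assumes "labeling L" "walk L n = (u, v)"
  obtains w where "walk L (Suc n) = (v, w)" "E v w" "L v w = next_port v (L u v)"
proof -
  have "E v u" using walk_edge[OF assms(1), of n] assms(2) sym by simp
  then obtain w where "E v w" "L v w = next_port v (L u v)"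
    using labeling_surj[OF assms(1)] next_port_range by metis
  then show ?thesis using that walk_Suc_if[OF assms] by blast
qed

text \<open>The walk reads only the labels of arcs it traverses. Since ports at a vertex are
  distinct, agreement on these arcs alone already identifies each successor.\<close>

lemma walk_cong:
  assumes L: "labeling L" and L': "labeling L'"
    and eq: "\<And>k u v. k \<le> n \<Longrightarrow> walk L k = (u, v) \<Longrightarrow> L' u v = L u v"
  shows "k \<le> n \<Longrightarrow> walk L' k = walk L k"
proof (induction k)
  case 0
  obtain w where w: "walk L 0 = (v0, w)" "E v0 w" "L v0 w = l" using walk_0[OF L] .
  then have "L' v0 w = l" using eq[of 0] by simp
  then show ?case using w the_arc_eq[OF L' w(2)] by (simp add: basic_walk.simps)
next
  case (Suc k)
  obtain u v where uv: "walk L k = (u, v)" by fastforce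
  obtain w where w: "walk L (Suc k) = (v, w)" "E v w" "L v w = next_port v (L u v)"
    using walk_SucE[OF L uv] .
  have "L' v w = next_port v (L' u v)"
    using eq[OF Suc.prems w(1)] eq[OF _ uv] w(3) Suc.prems by simp
  then show ?case using walk_Suc_if[OF L' _ w(2), of k u] Suc uv w(1) by simp
qed

section \<open>Repeated arcs and rerouting of the walk\<close>

definition trapped :: "'a set \<Rightarrow> ('a \<Rightarrow> 'a \<Rightarrow> nat) \<Rightarrow> bool" where
  "trapped Z L \<longleftrightarrow> (\<exists>m n. m < n \<and> walk L m = walk L n \<and> (\<forall>k\<le>n. fst (walk L k) \<in> Z))"

text \<open>All labels read up to the repetition belong to arcs with tails in \<open>Z\<close>, so
  the ports in \<open>Z\<close> decide the matter.\<close>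

lemma trapped_cycles:
  assumes "trapped Z L" "labeling L" "labeling L'" "\<And>v. v \<in> Z \<Longrightarrow> L' v = L v"
  shows "walk_cycles E L' v0 l"
proof -
  obtain m n where mn: "m < n" "walk L m = walk L n" "\<forall>k\<le>n. fst (walk L k) \<in> Z"
    using assms(1) unfolding trapped_def by blast
  have "walk L' k = walk L k" if "k \<le> n" for k
  proof (rule walk_cong[OF assms(2,3) _ that])
    fix j u v assume "j \<le> n" "walk L j = (u, v)"
    then have "u \<in> Z" using mn(3) by force
    then show "L' u v = L u v" using assms(4) by simp
  qed
  then show ?thesis using mn unfolding walk_cycles_def by (metis less_imp_le order_refl)
qed

text \<open>The tails of all arcs, including the next one, lie in \<open>Z\<close>, so a repetition
  now would be a trap. In proofs by contradiction this supplies the last premise of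
  \<open>steer\<close>.\<close>

lemma next_arc_fresh:
  assumes "\<not> trapped Z L" "walk L ` {..n} = R" "fst ` R \<subseteq> Z" "snd (walk L n) \<in> Z" "labeling L"
  shows "walk L (Suc n) \<notin> R"
proof
  assume "walk L (Suc n) \<in> R"
  then obtain m where "m \<le> n" "walk L m = walk L (Suc n)" using assms(2) by force
  moreover have "fst (walk L k) \<in> Z" if "k \<le> Suc n" for k
  proof (cases "k = Suc n")
    case True
    then show ?thesis using assms(4,5) walk_SucE[OF assms(5), of n] by (metis fst_conv prod.collapse)
  next
    case False
    then have "walk L k \<in> R" using that assms(2) by force
    then show ?thesis using assms(3) by blast
  qed
  ultimately show False using assms(1) unfolding trapped_def by (metis le_imp_less_Suc)
qed

text \<open>As long as neither arc has been traversed, exchanging the ports of two arcs leaving the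
  current vertex does not alter the walk so far; hence any untraversed arc can be made the next one.\<close>

lemma steer:
  assumes L: "labeling L" and R: "walk L ` {..n} = R" and x: "snd (walk L n) = x"
    and xw: "E x w" "(x, w) \<notin> R" and nx: "walk L (Suc n) \<notin> R"
  obtains L' where "labeling L'" "\<And>v. v \<noteq> x \<Longrightarrow> L' v = L v" "\<And>k. k \<le> n \<Longrightarrow> walk L' k = walk L k"
    "walk L' (Suc n) = (x, w)"
proof -
  obtain p where p: "walk L n = (p, x)" using x by (metis prod.collapse)
  obtain w' where w': "walk L (Suc n) = (x, w')" "E x w'" "L x w' = next_port x (L p x)"
    using walk_SucE[OF L p] .
  define L' where "L' = L(x := L x \<circ> Transposition.transpose w w')"
  have "L' v \<in> local_labelings E v" for v
  proof (cases "v = x")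
    case True
    have b: "bij_betw (L x) (nbrs E x) {1..deg E x}" and z: "\<forall>y. y \<notin> nbrs E x \<longrightarrow> L x y = 0"
      using L unfolding labeling_def local_labelings_def by auto
    have "bij_betw (Transposition.transpose w w') (nbrs E x) (nbrs E x)"
      by (rule bij_betw_byWitness[where f' = "Transposition.transpose w w'"])
        (use xw w' in \<open>auto simp: nbrs_def Transposition.transpose_def\<close>)
    then have "bij_betw (L x \<circ> Transposition.transpose w w') (nbrs E x) {1..deg E x}"
      using b bij_betw_trans by blast
    moreover have "\<forall>y. y \<notin> nbrs E x \<longrightarrow> (L x \<circ> Transposition.transpose w w') y = 0"
      using z xw w' by (auto simp: Transposition.transpose_def nbrs_def)
    ultimately show ?thesis using True by (simp add: L'_def local_labelings_def)
  next
    case False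
    then show ?thesis using L by (simp add: L'_def labeling_def)
  qed
  then have L': "labeling L'" by (simp add: labeling_def)
  have lab: "L' u v = L u v" if "(u, v) \<in> R" for u v
    using that xw nx w' by (auto simp: L'_def Transposition.transpose_def)
  have same: "walk L' k = walk L k" if "k \<le> n" for k
  proof (rule walk_cong[OF L L' _ that])
    fix k u v assume "k \<le> n" "walk L k = (u, v)"
    then have "(u, v) \<in> R" using R by force
    then show "L' u v = L u v" by (rule lab)
  qed
  have "L' x w = next_port x (L' p x)"
    using w' lab[of p x] R p by (force simp: L'_def)
  then have "walk L' (Suc n) = (x, w)"
    using walk_Suc_if[OF L' _ xw(1), of n p] same[of n] p by simp
  then show ?thesis using that L' same by (simp add: L'_def)
qed

subsection \<open>Trapping the walk\<close>

definition gdist :: "'a \<Rightarrow> 'a \<Rightarrow> nat" where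
  "gdist v w = (LEAST k. (E ^^ k) v w)"

lemma gdist_relpowp: "(E ^^ gdist v w) v w"
  unfolding gdist_def using connected[of v w] by (metis LeastI_ex rtranclp_imp_relpowp)

lemma gdist_le: "(E ^^ k) v w \<Longrightarrow> gdist v w \<le> k"
  unfolding gdist_def by (rule Least_le)

lemma gdist_self: "gdist v v = 0"
  using gdist_le[of 0 v v] by simp

lemma gdist_step: "E v w \<Longrightarrow> gdist v z \<le> Suc (gdist w z)"
  by (rule gdist_le) (rule relpowp_Suc_I2[OF _ gdist_relpowp])

lemma gdist_SucE:
  assumes "gdist v z = Suc k"
  obtains w where "E v w" "gdist w z = k"
proof -
  obtain w where w: "E v w" "(E ^^ k) w z"
    using gdist_relpowp[of v z] assms by (metis relpowp_Suc_D2)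
  then have "gdist w z = k" using gdist_le gdist_step[OF w(1), of z] assms by force
  then show ?thesis using that w by blast
qed

lemma finite_relpowp: "finite {w. (E ^^ k) v w}"
proof (induction k)
  case (Suc k)
  have "{w. (E ^^ Suc k) v w} = (\<Union>u\<in>{u. (E ^^ k) v u}. nbrs E u)"
    by (auto simp: nbrs_def)
  then show ?case using Suc fin_deg by simp
qed simp

lemma finite_ball: "finite {w. gdist v w \<le> k}"
proof -
  have "{w. gdist v w \<le> k} \<subseteq> (\<Union>j\<le>k. {w. (E ^^ j) v w})"
  proof
    fix w assume "w \<in> {w. gdist v w \<le> k}"
    then show "w \<in> (\<Union>j\<le>k. {w. (E ^^ j) v w})" using gdist_relpowp[of v w] by blast
  qed
  then show ?thesis by (rule finite_subset) (simp add: finite_relpowp)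
qed

lemma geodesic:
  "\<exists>y. y 0 = v \<and> (\<forall>j\<le>gdist v z. gdist (y j) z = gdist v z - j)
    \<and> (\<forall>j<gdist v z. E (y j) (y (Suc j)))"
proof -
  define nx where "nx u = (SOME w. E u w \<and> Suc (gdist w z) = gdist u z)" for u
  have nx: "E u (nx u) \<and> Suc (gdist (nx u) z) = gdist u z" if u: "gdist u z \<noteq> 0" for u
  proof -
    obtain k where k: "gdist u z = Suc k" using u not0_implies_Suc by blast
    obtain w where "E u w" "gdist w z = k" using gdist_SucE[OF k] .
    then have "E u w \<and> Suc (gdist w z) = gdist u z" using k by simp
    then show ?thesis unfolding nx_def by (rule someI)
  qed
  define y where "y j = (nx ^^ j) v" for j
  have y: "y 0 = v" "y (Suc j) = nx (y j)" for j by (simp_all add: y_def)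
  have d: "gdist (y j) z = gdist v z - j" if "j \<le> gdist v z" for j
    using that
  proof (induction j)
    case 0
    then show ?case by (simp add: y)
  next
    case (Suc j)
    then have "gdist (y j) z = gdist v z - j" by simp
    then have "Suc (gdist (y (Suc j)) z) = gdist v z - j"
      using nx[of "y j"] Suc.prems y(2)[of j] by simp
    then show ?case using Suc.prems by linarith
  qed
  have "E (y j) (y (Suc j))" if "j < gdist v z" for j
  proof -
    have "gdist (y j) z \<noteq> 0" using d[of j] that by simp
    then show ?thesis using nx[of "y j"] y(2)[of j] by simp
  qed
  then show ?thesis using d y(1) by blast
qed

text \<open>The morphological closing of \<open>F\<close>: its complement is the union of all balls of radius
  \<open>D + 2\<close> that avoid \<open>F\<close>, so a walk leaving it enters a ball none of whose vertices it has seen.\<close>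

definition closing :: "'a set \<Rightarrow> 'a set" where
  "closing F = {w. \<forall>z. gdist w z \<le> D + 2 \<longrightarrow> (\<exists>f\<in>F. gdist f z \<le> D + 2)}"

lemma closing_superset: "F \<subseteq> closing F"
  unfolding closing_def by auto

text \<open>Taking \<open>z = w\<close> in the definition puts each \<open>w\<close> of the closing
  within distance \<open>D + 2\<close> of a point of \<open>F\<close>.\<close>

lemma finite_closing:
  assumes "finite F"
  shows "finite (closing F)"
proof -
  have "closing F \<subseteq> (\<Union>f\<in>F. {w. gdist f w \<le> D + 2})"
    unfolding closing_def using gdist_self by force
  then show ?thesis by (rule finite_subset) (simp add: assms finite_ball)
qed

text \<open>A ball of radius \<open>D + 2\<close> that avoids \<open>F\<close> avoids the whole
  closing. It contains \<open>v\<close> but not the neighbour \<open>p\<close>, so \<open>v\<close>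
  lies exactly on its boundary.\<close>

lemma exit_closing:
  assumes "p \<in> closing F" "v \<notin> closing F" "E p v"
  obtains z where "gdist v z = D + 2" "\<And>w. gdist w z \<le> D + 2 \<Longrightarrow> w \<notin> closing F"
proof -
  obtain z where z: "gdist v z \<le> D + 2" "\<not> (\<exists>f\<in>F. gdist f z \<le> D + 2)"
    using assms(2) unfolding closing_def by blast
  have out: "w \<notin> closing F" if "gdist w z \<le> D + 2" for w
    using that z(2) unfolding closing_def by blast
  have "\<not> gdist p z \<le> D + 2" using out assms(1) by blast
  then have "gdist v z = D + 2" using z(1) gdist_step[OF assms(3), of z] by simp
  then show ?thesis using that out by blast
qed

section \<open>The local trap\<close>

lemma return_ports_differ:
  assumes "p \<noteq> r" "p \<in> {1..d}" "r \<in> {1..d}" "d \<le> deg E x"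
  shows "next_port x p \<noteq> next_port x r"
proof
  assume "next_port x p = next_port x r"
  then have m: "p mod deg E x = r mod deg E x" by (simp add: next_port_def)
  \<comment> \<open>Reduction modulo \<open>deg E x\<close> is injective on
    \<open>{1..deg E x}\<close>, because only the top value wraps around to
    \<open>0\<close>.\<close>
  have *: "q mod deg E x = (if q = deg E x then 0 else q)" if "q \<in> {1..d}" for q
    using that assms(4) by auto
  show False using m *[OF assms(2)] *[OF assms(3)] assms by (auto split: if_splits)
qed

text \<open>Without a trap, both the direct return \<open>y -> x\<close> and the detour
  \<open>y -> y2 -> y -> x\<close> would have to leave \<open>x\<close> towards \<open>u\<close>.
  The first arc out of \<open>y\<close> carries the same port both times, but only in the direct
  return is it the arc that enters \<open>x\<close>.\<close>

lemma bounce_trap: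
  assumes L: "labeling L" and R: "walk L ` {..n} = R" and R_xy: "walk L n = (x, y)"
    and used: "\<And>w. E x w \<Longrightarrow> w \<noteq> u \<Longrightarrow> (x, w) \<in> R"
    and fresh: "y \<notin> fst ` R" "y2 \<notin> fst ` R"
    and E: "E y y2" "y2 \<noteq> x" "deg E y \<le> deg E x"
    and Z: "fst ` R \<subseteq> Z" "x \<in> Z" "y \<in> Z" "y2 \<in> Z"
  shows "\<exists>L'. labeling L' \<and> (\<forall>v. v \<noteq> y \<longrightarrow> v \<noteq> y2 \<longrightarrow> L' v = L v) \<and> trapped Z L'"
proof (rule ccontr)
  assume "\<not> ?thesis"
  then have nt: "\<not> trapped Z L'"
    if "labeling L'" "\<And>v. v \<noteq> y \<Longrightarrow> v \<noteq> y2 \<Longrightarrow> L' v = L v" for L'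
    using that by blast
  have Exy: "E x y" using walk_edge[OF L, of n] R_xy by simp
  have Eyx: "E y x" using Exy sym by blast
  have xy: "x \<noteq> y" and yy: "y \<noteq> y2" using Exy E irrefl by blast+
  \<comment> \<open>As nothing is trapped, the next arc is new, and \<open>steer\<close> can replace
    it by any untraversed arc \<open>(a, b)\<close> at the cost of changing ports at
    \<open>a\<close> only.\<close>
  have step: "\<exists>L'. labeling L' \<and> (\<forall>v. v \<noteq> a \<longrightarrow> L' v = M v) \<and> walk L' ` {..Suc k} = insert (a, b) S
      \<and> (\<forall>i\<le>k. walk L' i = walk M i) \<and> walk L' (Suc k) = (a, b)"
    if "labeling M" "\<And>v. v \<noteq> y \<Longrightarrow> v \<noteq> y2 \<Longrightarrow> M v = L v" "walk M ` {..k} = S" "fst ` S \<subseteq> Z"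
      "snd (walk M k) = a" "a \<in> Z" "E a b" "(a, b) \<notin> S" for M k S a b
  proof -
    have "walk M (Suc k) \<notin> S"
      using next_arc_fresh[OF nt[OF that(1,2)] that(3,4)] that(1,5,6) by blast
    from steer[OF that(1,3,5,7,8) this] obtain L' where L': "labeling L'" "\<And>v. v \<noteq> a \<Longrightarrow> L' v = M v"
      "\<And>i. i \<le> k \<Longrightarrow> walk L' i = walk M i" "walk L' (Suc k) = (a, b)"
      by blast
    have "walk L' ` {..Suc k} = insert (a, b) S"
      using L'(3,4) that(3) by (simp add: atMost_Suc)
    then show ?thesis using L' by blast
  qed
  \<comment> \<open>Every other arc out of \<open>x\<close> has been used, so a return to
    \<open>x\<close> forces the exit to \<open>u\<close>; the ports at \<open>x\<close> are still
    those of \<open>L\<close>.\<close>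
  have last: "next_port x (M y x) = L x u"
    if M: "labeling M" "\<And>v. v \<noteq> y \<Longrightarrow> v \<noteq> y2 \<Longrightarrow> M v = L v" and S: "walk M ` {..k} = S" "fst ` S \<subseteq> Z" "R \<subseteq> S"
      and k: "walk M k = (y, x)" for M k S
  proof -
    obtain w where w: "walk M (Suc k) = (x, w)" "E x w" "M x w = next_port x (M y x)"
      using walk_SucE[OF M(1) k] .
    moreover have "walk M (Suc k) \<notin> S"
      using next_arc_fresh[OF nt[OF M] S(1,2)] M(1) k Z by simp
    ultimately have "w = u" using used[OF w(2)] S(3) by auto
    then show ?thesis using w(3) M(2)[of x] xy E(2) by simp
  qed
  have y_arc: "M y b = next_port y (L x y)"
    if "labeling M" "\<And>v. v \<noteq> y \<Longrightarrow> v \<noteq> y2 \<Longrightarrow> M v = L v" "walk M n = (x, y)" "walk M (Suc n) = (y, b)" for M b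
    using walk_SucE[OF that(1,3)] that(2)[of x] that(4) xy E(2) by (metis prod.inject)
  have yR: "(y, b) \<notin> R" "(y2, b) \<notin> R" for b using fresh by force+
  obtain L1 where L1: "labeling L1" "\<forall>v. v \<noteq> y \<longrightarrow> L1 v = L v" "walk L1 ` {..Suc n} = insert (y, x) R"
      "\<forall>i\<le>n. walk L1 i = walk L i" "walk L1 (Suc n) = (y, x)"
    using step[OF L refl R Z(1) _ Z(3) Eyx yR(1)] R_xy by auto
  have "next_port x (L1 y x) = L x u"
    by (rule last[OF L1(1) _ L1(3) _ _ L1(5)]) (use L1 Z E in auto)
  moreover have "L1 y x = next_port y (L x y)"
    by (rule y_arc[OF L1(1)]) (simp_all add: L1(2,4,5) R_xy)
  ultimately have one: "next_port x (next_port y (L x y)) = L x u" by simp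
  obtain L2 where L2: "labeling L2" "\<forall>v. v \<noteq> y \<longrightarrow> L2 v = L v" "walk L2 ` {..Suc n} = insert (y, y2) R"
      "\<forall>i\<le>n. walk L2 i = walk L i" "walk L2 (Suc n) = (y, y2)"
    using step[OF L refl R Z(1) _ Z(3) E(1) yR(1)] R_xy by auto
  have "\<exists>L3. labeling L3 \<and> (\<forall>v. v \<noteq> y2 \<longrightarrow> L3 v = L2 v)
      \<and> walk L3 ` {..Suc (Suc n)} = insert (y2, y) (insert (y, y2) R)
      \<and> (\<forall>i\<le>Suc n. walk L3 i = walk L2 i) \<and> walk L3 (Suc (Suc n)) = (y2, y)"
    by (rule step[OF L2(1) _ L2(3)]) (use L2 Z E sym yR yy in auto)
  then obtain L3 where L3: "labeling L3" "\<forall>v. v \<noteq> y2 \<longrightarrow> L3 v = L2 v"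
      "walk L3 ` {..Suc (Suc n)} = insert (y2, y) (insert (y, y2) R)"
      "\<forall>i\<le>Suc n. walk L3 i = walk L2 i" "walk L3 (Suc (Suc n)) = (y2, y)"
    by blast
  have "\<exists>L4. labeling L4 \<and> (\<forall>v. v \<noteq> y \<longrightarrow> L4 v = L3 v)
      \<and> walk L4 ` {..Suc (Suc (Suc n))} = insert (y, x) (insert (y2, y) (insert (y, y2) R))
      \<and> (\<forall>i\<le>Suc (Suc n). walk L4 i = walk L3 i) \<and> walk L4 (Suc (Suc (Suc n))) = (y, x)"
    by (rule step[OF L3(1) _ L3(3)]) (use L2 L3 Z E Eyx yR yy in auto)
  then obtain L4 where L4: "labeling L4" "\<forall>v. v \<noteq> y \<longrightarrow> L4 v = L3 v"
      "walk L4 ` {..Suc (Suc (Suc n))} = insert (y, x) (insert (y2, y) (insert (y, y2) R))"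
      "\<forall>i\<le>Suc (Suc n). walk L4 i = walk L3 i" "walk L4 (Suc (Suc (Suc n))) = (y, x)"
    by blast
  have L4L: "L4 v = L v" if "v \<noteq> y" "v \<noteq> y2" for v using L2 L3 L4 that by simp
  have two: "next_port x (L4 y x) = L x u"
    by (rule last[OF L4(1) L4L L4(3) _ _ L4(5)]) (use Z E in auto)
  have "L4 y y2 = next_port y (L x y)"
    by (rule y_arc[OF L4(1) L4L]) (simp_all add: L2(4,5) L3(4) L4(4) R_xy)
  \<comment> \<open>Two distinct ports at \<open>y\<close> now have the same successor at
    \<open>x\<close>, which \<open>deg E y \<le> deg E x\<close> forbids.\<close>
  then have "next_port x (L4 y y2) = next_port x (L4 y x)" using one two by simp
  moreover have "L4 y y2 \<noteq> L4 y x" using labeling_inj[OF L4(1) E(1) Eyx] E(2) by blast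
  ultimately show False
    using return_ports_differ[of "L4 y y2" "L4 y x" "deg E y" x] labeling_range[OF L4(1)] E Eyx by auto
qed

lemma arc_notin: "a \<notin> fst ` R \<Longrightarrow> (a, b) \<notin> R"
  by force

text \<open>Otherwise the degrees would rise strictly from at least \<open>1\<close> at
  \<open>y 1\<close> to at least \<open>D + 1\<close> at \<open>y (Suc D)\<close>. Starting at index
  \<open>1\<close> leaves the chosen vertex a predecessor on the path.\<close>

lemma non_increasing_degree:
  assumes "E (y 1) w"
  obtains i where "1 \<le> i" "i \<le> D" "deg E (y (Suc i)) \<le> deg E (y i)"
proof (rule ccontr)
  assume "\<not> thesis"
  then have less: "deg E (y i) < deg E (y (Suc i))" if "1 \<le> i" "i \<le> D" for i
    using \<open>\<not> thesis\<close> \<open>\<And>i. 1 \<le> i \<Longrightarrow> i \<le> D \<Longrightarrow> deg E (y (Suc i)) \<le> deg E (y i) \<Longrightarrow> thesis\<close> that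
    by (meson not_le)
  have "Suc k \<le> deg E (y (Suc k))" if "k \<le> D" for k
    using that
  proof (induction k)
    case 0
    then show ?case using deg_pos[OF assms] by simp
  next
    case (Suc k)
    then show ?case using less[of "Suc k"] by simp
  qed
  from this[of D] show False using bdd_deg[of "y (Suc D)"] by simp
qed

text \<open>The trap touches no port in the closing, and the size of \<open>W\<close> is bounded in
  terms of \<open>D\<close> alone. This yields a lower bound on its probability that is uniform in
  \<open>F\<close> and \<open>L0\<close>.\<close>

lemma trap_exists:
  assumes F: "finite F" "v0 \<in> F" and L0: "labeling L0"
  shows "\<exists>W L1. finite W \<and> card W \<le> 2 * D + 3 \<and> W \<inter> closing F = {} \<and> labeling L1
    \<and> (\<forall>v\<in>closing F. L1 v = L0 v) \<and> trapped (closing F \<union> W) L1"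
proof (cases "\<forall>n. snd (walk L0 n) \<in> closing F")
  case True
  have f: "fst (walk L0 n) \<in> closing F" for n
  proof (cases n)
    case 0
    then show ?thesis using walk_0[OF L0] F(2) closing_superset by (metis fst_conv subsetD)
  next
    case (Suc k)
    then show ?thesis using True walk_SucE[OF L0, of k] by (metis fst_conv prod.collapse)
  qed
  \<comment> \<open>Only finitely many arcs are available, so one is repeated and
    \<open>W = {}\<close> suffices.\<close>
  have "walk L0 n \<in> closing F \<times> closing F" for n using True f by (simp add: mem_Times_iff)
  then have "range (walk L0) \<subseteq> closing F \<times> closing F" by blast
  then have "finite (range (walk L0))"
    by (rule finite_subset) (simp add: finite_closing F)
  then have "\<not> inj (walk L0)" using finite_imageD infinite_UNIV_nat by blast
  then obtain m n where "m \<noteq> n" "walk L0 m = walk L0 n" unfolding inj_def by blast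
  then have "trapped (closing F) L0" unfolding trapped_def using f by (metis linorder_neqE_nat)
  then show ?thesis using L0 by (intro exI[of _ "{}"] exI[of _ L0]) simp
next
  case False
  \<comment> \<open>Arc \<open>t\<close> is the first whose head lies outside the closing; all
    labels read so far sit at vertices of the closing.\<close>
  define t where "t = (LEAST n. snd (walk L0 n) \<notin> closing F)"
  have t: "snd (walk L0 t) \<notin> closing F"
    unfolding t_def using False by (metis (mono_tags, lifting) LeastI_ex)
  have before: "snd (walk L0 k) \<in> closing F" if "k < t" for k
    using that not_less_Least unfolding t_def by blast
  have tails: "fst (walk L0 k) \<in> closing F" if "k \<le> t" for k
  proof (cases k)
    case 0
    then show ?thesis using walk_0[OF L0] F(2) closing_superset by (metis fst_conv subsetD)
  next
    case (Suc j)
    then have "snd (walk L0 j) \<in> closing F" using before that by simp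
    then show ?thesis using Suc walk_SucE[OF L0, of j] by (metis fst_conv prod.collapse)
  qed
  obtain p v where pv: "walk L0 t = (p, v)" by fastforce
  have "E p v" "p \<in> closing F" "v \<notin> closing F"
    using pv t tails[of t] walk_edge[OF L0, of t] by simp_all
  then obtain z where z: "gdist v z = D + 2" "\<And>w. gdist w z \<le> D + 2 \<Longrightarrow> w \<notin> closing F"
    using exit_closing[of p F v] by metis
  obtain y where y: "y 0 = v" "\<forall>j\<le>D + 2. gdist (y j) z = D + 2 - j" "\<forall>j<D + 2. E (y j) (y (Suc j))"
    using geodesic[of v z] z(1) by auto
  have "E (y 1) (y 2)" using y(3) by (simp add: numeral_2_eq_2)
  then obtain i where i: "1 \<le> i" "i \<le> D" "deg E (y (Suc i)) \<le> deg E (y i)"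
    using non_increasing_degree[of y] by blast
  obtain h where h: "i = Suc h" using i(1) by (cases i) auto
  have y_inj: "y j \<noteq> y k" if "j < k" "k \<le> D + 2" for j k
  proof
    assume "y j = y k"
    then have "D + 2 - j = D + 2 - k" using y(2) that by (metis less_imp_le_nat order_trans)
    then show False using that by simp
  qed
  have y_out: "y j \<notin> closing F" if "j \<le> D + 2" for j
    using z(2)[of "y j"] y(2) that by simp
  define x where "x = y i"
  \<comment> \<open>The distance to \<open>z\<close> drops by one at each path vertex and changes by
    at most one along an edge. Since \<open>1 \<le> i\<close>, neighbours of \<open>x\<close> remain
    in the ball, and a geodesic has no shortcuts from \<open>x\<close> to path vertices two or more
    steps away.\<close>
  have nb: "w \<notin> closing F" "\<And>j. j < h \<Longrightarrow> w \<noteq> y j" "w \<noteq> y (Suc (Suc i))" if "E x w" for w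
  proof -
    have dx: "gdist x z = D + 2 - i" using y(2) i by (simp add: x_def)
    have up: "gdist w z \<le> Suc (D + 2 - i)" and lo: "D + 2 - i \<le> Suc (gdist w z)"
      using gdist_step[OF sym[OF that], of z] gdist_step[OF that, of z] dx by simp_all
    show "w \<notin> closing F" using z(2) up i by simp
    show "w \<noteq> y j" if "j < h" for j
      using y(2)[rule_format, of j] up that h i by auto
    show "w \<noteq> y (Suc (Suc i))"
      using y(2)[rule_format, of "Suc (Suc i)"] lo i by auto
  qed
  \<comment> \<open>At most \<open>i + 3 \<le> D + 3\<close> path vertices together with at most
    \<open>D\<close> neighbours of \<open>x\<close>.\<close>
  define W where "W = y ` {..Suc (Suc i)} \<union> nbrs E x"
  have "card W \<le> card (y ` {..Suc (Suc i)}) + deg E x"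
    unfolding W_def deg_def by (rule card_Un_le)
  also have "\<dots> \<le> card {..Suc (Suc i)} + D" by (intro add_mono card_image_le bdd_deg) simp
  finally have cardW: "card W \<le> 2 * D + 3" using i by simp
  have finW: "finite W" by (simp add: W_def fin_deg)
  have disj: "W \<inter> closing F = {}"
    using y_out nb(1) i unfolding W_def nbrs_def by auto
  define Z where "Z = closing F \<union> W"
  show ?thesis
  proof (rule ccontr)
    assume neg: "\<not> ?thesis"
    \<comment> \<open>A labeling trapped in \<open>Z\<close> that keeps the ports in the closing
      would be the required \<open>L1\<close>, so every such labeling can be steered freely inside
      \<open>W\<close>.\<close>
    have nt: "\<not> trapped Z L" if "labeling L" "\<And>v. v \<in> closing F \<Longrightarrow> L v = L0 v" for L
      using neg that finW cardW disj unfolding Z_def by blast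
    define reach where "reach R a b \<longleftrightarrow> (\<exists>L n. labeling L \<and> (\<forall>v\<in>closing F. L v = L0 v)
      \<and> walk L ` {..n} = R \<and> walk L n = (a, b))" for R a b
    have move: "reach (insert (b, c) R) b c"
      if "reach R a b" "b \<in> W" "E b c" "(b, c) \<notin> R" "fst ` R \<subseteq> Z" for R a b c
    proof -
      obtain L n where L: "labeling L" "\<forall>v\<in>closing F. L v = L0 v" "walk L ` {..n} = R" "walk L n = (a, b)"
        using \<open>reach R a b\<close> unfolding reach_def by blast
      have b: "snd (walk L n) = b" "b \<in> Z" using L(4) that(2) by (simp_all add: Z_def)
      have "walk L (Suc n) \<notin> R"
        using next_arc_fresh[OF nt[OF L(1)] L(3) that(5) _ L(1)] L(2) b by simp
      from steer[OF L(1,3) b(1) that(3,4) this] obtain L' where L': "labeling L'"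
        "\<And>v. v \<noteq> b \<Longrightarrow> L' v = L v" "\<And>k. k \<le> n \<Longrightarrow> walk L' k = walk L k" "walk L' (Suc n) = (b, c)"
        by blast
      have "walk L' ` {..Suc n} = insert (b, c) R"
        using L'(3,4) L(3) by (simp add: atMost_Suc)
      moreover have "\<forall>v\<in>closing F. L' v = L0 v"
      proof
        fix v assume v: "v \<in> closing F"
        then have "v \<noteq> b" using that(2) disj by blast
        then show "L' v = L0 v" using L'(2) L(2) v by simp
      qed
      ultimately show ?thesis unfolding reach_def using L'(1,4) by blast
    qed
    define R0 where "R0 = walk L0 ` {..t}"
    have R0: "fst ` R0 \<subseteq> closing F" using tails unfolding R0_def by auto
    define P where "P j = R0 \<union> (\<lambda>k. (y k, y (Suc k))) ` {..<j}" for j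
    have fstP: "fst ` P j = fst ` R0 \<union> y ` {..<j}" for j
      unfolding P_def by (simp add: image_Un image_image)
    have PZ: "fst ` P j \<subseteq> Z" if "j \<le> i" for j
      using R0 that unfolding fstP Z_def W_def by auto
    have start: "reach (P 0) p (y 0)"
      unfolding reach_def P_def R0_def using L0 pv y(1) by auto
    \<comment> \<open>Path vertices not yet left have only untraversed outgoing arcs, so the walk
      can be led on along the geodesic.\<close>
    have y_new: "y j \<notin> fst ` P k" if jk: "k \<le> j" "j \<le> D + 2" for j k
    proof
      assume "y j \<in> fst ` P k"
      then obtain m where "m < k" "y j = y m"
        using y_out[OF jk(2)] R0 unfolding fstP by blast
      then show False using y_inj[of m j] jk by simp
    qed
    have path: "\<exists>a. reach (P j) a (y j)" if "j \<le> i" for j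
      using that
    proof (induction j)
      case 0
      then show ?case using start by blast
    next
      case (Suc j)
      then obtain a where a: "reach (P j) a (y j)" by auto
      have "reach (insert (y j, y (Suc j)) (P j)) (y j) (y (Suc j))"
      proof (rule move[OF a])
        show "y j \<in> W" using Suc.prems by (auto simp: W_def)
        show "E (y j) (y (Suc j))" using y(3) Suc.prems i by simp
        show "(y j, y (Suc j)) \<notin> P j" using arc_notin[OF y_new[of j j]] Suc.prems i by simp
        show "fst ` P j \<subseteq> Z" using PZ Suc.prems by simp
      qed
      moreover have "insert (y j, y (Suc j)) (P j) = P (Suc j)"
        unfolding P_def by (auto simp: lessThan_Suc)
      ultimately show ?case by auto
    qed
    define u where "u = y h"
    define v1 where "v1 = y (Suc i)"
    have xW: "x \<in> W" by (auto simp: x_def W_def)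
    have x_new: "x \<notin> fst ` P i" using y_new[of i i] i by (simp add: x_def)
    have nb_new: "w \<notin> fst ` P i" if "E x w" "w \<noteq> u" for w
      using nb(1,2)[OF that(1)] that(2) R0 unfolding fstP h u_def by (auto simp: lessThan_Suc)
    \<comment> \<open>One bounce \<open>x -> w -> x\<close> is added per neighbour. By
      \<open>nb_new\<close> and \<open>w \<notin> B\<close>, the walk has not left \<open>w\<close>
      before, so the way back is free.\<close>
    have bounce: "\<exists>a. reach (P i \<union> (\<Union>w\<in>B. {(x, w), (w, x)})) a x"
      if "finite B" "B \<subseteq> nbrs E x - {u, v1}" for B
      using that
    proof (induction B rule: finite_induct)
      case empty
      then show ?case using path[of i] by (simp add: x_def)
    next
      case (insert w B)
      define S where "S = P i \<union> (\<Union>w\<in>B. {(x, w), (w, x)})"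
      obtain a where a: "reach S a x" using insert unfolding S_def by auto
      have w: "E x w" "w \<noteq> u" "w \<noteq> x" "x \<notin> B" and BW: "B \<subseteq> W"
        using insert.prems irrefl by (auto simp: nbrs_def W_def)
      have SZ: "fst ` S \<subseteq> Z"
        using PZ[of i] xW BW unfolding S_def by (auto simp: Z_def)
      have "(x, w) \<notin> S" using arc_notin[OF x_new] w insert.hyps(2) unfolding S_def by blast
      then have 1: "reach (insert (x, w) S) x w" using move[OF a xW w(1) _ SZ] by blast
      have "(w, x) \<notin> insert (x, w) S"
        using arc_notin[OF nb_new[OF w(1,2)]] w insert.hyps(2) unfolding S_def by blast
      moreover have "w \<in> W" using w(1) by (simp add: W_def nbrs_def)
      moreover have "fst ` insert (x, w) S \<subseteq> Z" using SZ xW by (simp add: Z_def)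
      ultimately have "reach (insert (w, x) (insert (x, w) S)) w x"
        using move[OF 1 _ sym[OF w(1)]] by blast
      moreover have "insert (w, x) (insert (x, w) S) = P i \<union> (\<Union>w\<in>insert w B. {(x, w), (w, x)})"
        unfolding S_def by auto
      ultimately show ?case by auto
    qed
    define B where "B = nbrs E x - {u, v1}"
    define S where "S = P i \<union> (\<Union>w\<in>B. {(x, w), (w, x)})"
    have v1: "E x v1" "v1 \<noteq> x" "v1 \<noteq> u" "v1 \<notin> B"
    proof -
      show e: "E x v1" using y(3) i by (simp add: x_def v1_def)
      show "v1 \<noteq> x" using e irrefl by blast
      show "v1 \<noteq> u" using y_inj[of h "Suc i"] h i by (simp add: v1_def u_def)
      show "v1 \<notin> B" by (simp add: B_def)
    qed
    obtain a where a: "reach S a x" using bounce[of B] fin_deg unfolding S_def B_def by auto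
    have SZ: "fst ` S \<subseteq> Z"
      using PZ[of i] xW unfolding S_def B_def by (auto simp: Z_def W_def)
    have v1P: "v1 \<notin> fst ` P i" using nb_new v1 by blast
    have "(x, v1) \<notin> S" using arc_notin[OF x_new] v1 unfolding S_def by blast
    then have "reach (insert (x, v1) S) x v1" using move[OF a xW v1(1) _ SZ] by blast
    then obtain L n where L: "labeling L" "\<forall>v\<in>closing F. L v = L0 v"
      "walk L ` {..n} = insert (x, v1) S" "walk L n = (x, v1)"
      unfolding reach_def by blast
    define v2 where "v2 = y (Suc (Suc i))"
    have v2: "E v1 v2" "v2 \<noteq> x" "v2 \<notin> nbrs E x"
      using y(3) i y_inj[of i "Suc (Suc i)"] nb(3) unfolding v1_def v2_def x_def nbrs_def by auto
    have v12: "v1 \<in> W" "v2 \<in> W" by (auto simp: v1_def v2_def W_def)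
    have "\<exists>L'. labeling L' \<and> (\<forall>v. v \<noteq> v1 \<longrightarrow> v \<noteq> v2 \<longrightarrow> L' v = L v) \<and> trapped Z L'"
    proof (rule bounce_trap[OF L(1,3,4)])
      show "(x, w) \<in> insert (x, v1) S" if "E x w" "w \<noteq> u" for w
        using that unfolding S_def B_def by (auto simp: nbrs_def)
      show "v1 \<notin> fst ` insert (x, v1) S" using v1P v1 unfolding S_def by auto
      show "v2 \<notin> fst ` insert (x, v1) S"
        using y_new[of i "Suc (Suc i)"] i v2 unfolding S_def B_def by (auto simp: v2_def)
      show "E v1 v2" "v2 \<noteq> x" using v2 by blast+
      show "deg E v1 \<le> deg E x" using i by (simp add: v1_def x_def)
      show "fst ` insert (x, v1) S \<subseteq> Z" "x \<in> Z" "v1 \<in> Z" "v2 \<in> Z"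
        using SZ xW v12 by (auto simp: Z_def)
    qed
    then obtain L' where L': "labeling L'" "\<And>v. v \<noteq> v1 \<Longrightarrow> v \<noteq> v2 \<Longrightarrow> L' v = L v" "trapped Z L'"
      by blast
    have "L' v = L0 v" if "v \<in> closing F" for v
    proof -
      have "v \<noteq> v1" "v \<noteq> v2" using v12 disj that by auto
      then show ?thesis using L'(2) L(2) that by simp
    qed
    then show False using nt[OF L'(1)] L'(3) by blast
  qed
qed

subsection \<open>The escape probability\<close>

lemma local_labelings_nonempty: "local_labelings E v \<noteq> {}"
proof -
  obtain g where g: "bij_betw g (nbrs E v) {1..deg E v}"
    using finite_same_card_bij[OF fin_deg[of v] finite_atLeastAtMost, of 1 "deg E v"] by (auto simp: deg_def)
  define f where "f w = (if w \<in> nbrs E v then g w else 0)" for w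
  have "bij_betw f (nbrs E v) {1..deg E v}"
    using g bij_betw_cong[of "nbrs E v" f g] by (simp add: f_def)
  then have "f \<in> local_labelings E v" by (simp add: local_labelings_def f_def)
  then show ?thesis by blast
qed

text \<open>Restriction to the neighbours is injective because of the default value
  \<open>0\<close>, and the values are at most \<open>D\<close>. The bound is crude but depends on
  \<open>D\<close> alone.\<close>

lemma local_labelings_finite_card:
  "finite (local_labelings E v)" "card (local_labelings E v) \<le> (D + 1) ^ D"
proof -
  let ?r = "\<lambda>f::'a \<Rightarrow> nat. restrict f (nbrs E v)"
  have inj: "inj_on ?r (local_labelings E v)"
  proof (rule inj_onI)
    fix f g assume fg: "f \<in> local_labelings E v" "g \<in> local_labelings E v" "?r f = ?r g"
    show "f = g"
    proof
      fix w
      show "f w = g w"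
      proof (cases "w \<in> nbrs E v")
        case True
        then show ?thesis using fun_cong[OF fg(3), of w] by simp
      next
        case False
        then show ?thesis using fg(1,2) by (simp add: local_labelings_def)
      qed
    qed
  qed
  have img: "?r ` local_labelings E v \<subseteq> nbrs E v \<rightarrow>\<^sub>E {..D}"
  proof
    fix h assume "h \<in> ?r ` local_labelings E v"
    then obtain f where f: "f \<in> local_labelings E v" "h = ?r f" by blast
    have "f w \<le> D" if "w \<in> nbrs E v" for w
    proof -
      have "f w \<in> {1..deg E v}" using f(1) that bij_betwE by (fastforce simp: local_labelings_def)
      then show ?thesis using bdd_deg[of v] by simp
    qed
    then show "h \<in> nbrs E v \<rightarrow>\<^sub>E {..D}" using f(2) by simp
  qed
  have fin: "finite (nbrs E v \<rightarrow>\<^sub>E {..D})" by (intro finite_PiE fin_deg) simp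
  show "finite (local_labelings E v)"
    using finite_imageD[OF finite_subset[OF img fin] inj] .
  have "card (local_labelings E v) \<le> card (nbrs E v \<rightarrow>\<^sub>E {..D})"
    by (rule card_inj_on_le[OF inj img fin])
  also have "\<dots> = (D + 1) ^ deg E v" by (simp add: card_PiE[OF fin_deg] deg_def)
  also have "\<dots> \<le> (D + 1) ^ D" by (intro power_increasing bdd_deg) simp
  finally show "card (local_labelings E v) \<le> (D + 1) ^ D" .
qed

abbreviation port_pmf :: "'a \<Rightarrow> ('a \<Rightarrow> nat) pmf" where
  "port_pmf v \<equiv> pmf_of_set (local_labelings E v)"

lemma set_port_pmf: "set_pmf (port_pmf v) = local_labelings E v"
  using local_labelings_nonempty local_labelings_finite_card(1) by (rule set_pmf_of_set)

lemma pmf_port_pmf_ge: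
  assumes "f \<in> local_labelings E v"
  shows "1 / real ((D + 1) ^ D) \<le> pmf (port_pmf v) f"
proof -
  have "pmf (port_pmf v) f = 1 / real (card (local_labelings E v))"
    using assms by (simp add: pmf_of_set[OF local_labelings_nonempty local_labelings_finite_card(1)])
  moreover have "0 < card (local_labelings E v)"
    using local_labelings_nonempty local_labelings_finite_card(1) by (simp add: card_gt_0_iff)
  moreover have "real (card (local_labelings E v)) \<le> real ((D + 1) ^ D)"
    using local_labelings_finite_card(2) by (rule of_nat_mono)
  ultimately show ?thesis by (simp only:) (intro divide_left_mono mult_pos_pos; simp)
qed

section \<open>The product space and measurability of the walk\<close>

sublocale ports: product_prob_space "\<lambda>v. measure_pmf (port_pmf v)" UNIV
  by (intro product_prob_spaceI measure_pmf.prob_space_axioms)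

sublocale labelings: prob_space "random_labeling E"
  unfolding random_labeling_def by (rule ports.prob_space_axioms)

lemma space_random_labeling: "space (random_labeling E) = UNIV"
  by (simp add: random_labeling_def space_PiM)

lemma measurable_port [measurable]: "(\<lambda>L. L v) \<in> random_labeling E \<rightarrow>\<^sub>M count_space UNIV"
proof -
  have "(\<lambda>L. L v) \<in> random_labeling E \<rightarrow>\<^sub>M measure_pmf (port_pmf v)"
    unfolding random_labeling_def by (rule measurable_component_singleton) simp
  then show ?thesis by simp
qed

lemma measurable_port_fun: "(\<lambda>L. h (L v)) \<in> random_labeling E \<rightarrow>\<^sub>M count_space UNIV"
  by (rule measurable_compose[OF measurable_port]) simp

text \<open>The next arc is a function of the current arc, which has countably many values, and of
  the ports at its two ends, which are measurable into discrete spaces.\<close>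

lemma measurable_walk [measurable]:
  "(\<lambda>L. walk L n) \<in> random_labeling E \<rightarrow>\<^sub>M count_space UNIV"
proof (induction n)
  case 0
  show ?case unfolding basic_walk.simps by (rule measurable_port_fun)
next
  case (Suc n)
  define step where "step a L = (case a of (u, v) \<Rightarrow>
    (v, THE w. E v w \<and> L v w = (L u v mod deg E v) + 1))" for a and L :: "'a \<Rightarrow> 'a \<Rightarrow> nat"
  have "step (u, v) \<in> random_labeling E \<rightarrow>\<^sub>M count_space UNIV" for u v
  proof -
    have "(\<lambda>L. (\<lambda>i L. (v, THE w. E v w \<and> L v w = (i mod deg E v) + 1)) (L u v) L)
        \<in> random_labeling E \<rightarrow>\<^sub>M count_space UNIV"
      by (rule measurable_compose_countable[OF measurable_port_fun measurable_port_fun])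
    then show ?thesis by (simp add: step_def[abs_def])
  qed
  then have "(\<lambda>L. step a L) \<in> random_labeling E \<rightarrow>\<^sub>M count_space UNIV" for a
    by (cases a) simp
  then have "(\<lambda>L. step (walk L n) L) \<in> random_labeling E \<rightarrow>\<^sub>M count_space UNIV"
    by (rule measurable_compose_countable[OF _ Suc])
  moreover have "walk L (Suc n) = step (walk L n) L" for L
    unfolding basic_walk.simps(2) step_def Let_def ..
  ultimately show ?case by (simp only:)
qed

lemma sets_cycles: "{L. walk_cycles E L v0 l} \<in> sets (random_labeling E)"
proof -
  \<comment> \<open>Naming the common arc turns the coincidence into a countable union of events
    about single values of the walk.\<close>
  have "{L \<in> space (random_labeling E). walk_cycles E L v0 l} =
      {L \<in> space (random_labeling E). \<exists>m n. m < n \<and> (\<exists>a. walk L m = a \<and> walk L n = a)}"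
    unfolding walk_cycles_def by metis
  also have "\<dots> \<in> sets (random_labeling E)" by measurable
  finally show ?thesis by (simp add: space_random_labeling)
qed

lemma sets_labeling: "{L. labeling L} \<in> sets (random_labeling E)"
proof -
  have [measurable]: "Measurable.pred (random_labeling E) (\<lambda>L. L v \<in> local_labelings E v)" for v
    by (rule measurable_port_fun)
  have "{L \<in> space (random_labeling E). \<forall>v. L v \<in> local_labelings E v} \<in> sets (random_labeling E)"
    by measurable
  then show ?thesis by (simp add: space_random_labeling labeling_def)
qed

lemma AE_labeling: "AE L in random_labeling E. labeling L"
proof -
  have "AE L in random_labeling E. L v \<in> local_labelings E v" for v
    unfolding random_labeling_def
    by (rule AE_PiM_component) (auto simp: measure_pmf.prob_space_axioms AE_measure_pmf_iff set_port_pmf)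
  then show ?thesis unfolding labeling_def by (simp add: AE_all_countable)
qed

section \<open>Cylinder events and conditioning on finitely many ports\<close>

definition cyl :: "'a set \<Rightarrow> ('a \<Rightarrow> 'a \<Rightarrow> nat) \<Rightarrow> ('a \<Rightarrow> 'a \<Rightarrow> nat) set" where
  "cyl F \<sigma> = {L. \<forall>v\<in>F. L v = \<sigma> v}"

lemma sets_cyl:
  assumes "finite F"
  shows "cyl F \<sigma> \<in> sets (random_labeling E)"
proof -
  have [measurable]: "Measurable.pred (random_labeling E) (\<lambda>L. L v = \<sigma> v)" for v
    by (rule measurable_port_fun)
  have "{L \<in> space (random_labeling E). \<forall>v\<in>F. L v = \<sigma> v} \<in> sets (random_labeling E)"
    using assms by measurable
  then show ?thesis by (simp add: space_random_labeling cyl_def)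
qed

lemma prob_cyl:
  assumes "finite F"
  shows "measure (random_labeling E) (cyl F \<sigma>) = (\<Prod>v\<in>F. pmf (port_pmf v) (\<sigma> v))"
proof -
  have "cyl F \<sigma> = {L \<in> space (random_labeling E). \<forall>v\<in>F. L v \<in> {\<sigma> v}}"
    by (simp add: cyl_def space_random_labeling)
  then have "emeasure (random_labeling E) (cyl F \<sigma>) = (\<Prod>v\<in>F. emeasure (measure_pmf (port_pmf v)) {\<sigma> v})"
    using ports.emeasure_PiM_Collect[of F "\<lambda>v. {\<sigma> v}"] assms by (simp add: random_labeling_def)
  also have "\<dots> = ennreal (\<Prod>v\<in>F. pmf (port_pmf v) (\<sigma> v))"
    by (simp add: emeasure_pmf_single prod_ennreal)
  finally show ?thesis by (simp add: measure_def prod_nonneg)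
qed

text \<open>Non-labelings, a null set, are left out because traps are built from genuine labelings
  only.\<close>

definition escape :: "('a \<Rightarrow> 'a \<Rightarrow> nat) set" where
  "escape = {L. labeling L} - {L. walk_cycles E L v0 l}"

lemma sets_escape: "escape \<in> sets (random_labeling E)"
  unfolding escape_def using sets_labeling sets_cycles by blast

text \<open>Within the labelings, \<open>A\<close> splits into finitely many disjoint cylinders over
  \<open>F\<close>, one for each admissible choice of ports on \<open>F\<close>, and the bounds on
  these atoms add up.\<close>

lemma escape_bound_determined:
  assumes F: "finite F" and K: "0 \<le> K"
    and atoms: "\<And>\<sigma>. measure (random_labeling E) (escape \<inter> cyl F \<sigma>) \<le> K * measure (random_labeling E) (cyl F \<sigma>)"
    and A: "A \<in> sets (random_labeling E)"
    and det: "\<And>L L'. (\<And>v. v \<in> F \<Longrightarrow> L v = L' v) \<Longrightarrow> L \<in> A \<Longrightarrow> L' \<in> A"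
  shows "measure (random_labeling E) (escape \<inter> A) \<le> K * measure (random_labeling E) A"
proof -
  let ?P = "measure (random_labeling E)"
  define R where "R = {\<sigma> \<in> Pi\<^sub>E F (local_labelings E). cyl F \<sigma> \<subseteq> A}"
  have "finite (Pi\<^sub>E F (local_labelings E))"
    by (intro finite_PiE F local_labelings_finite_card(1))
  then have finR: "finite R" unfolding R_def by simp
  have disj: "disjoint_family_on (cyl F) R"
  proof (unfold disjoint_family_on_def, intro ballI impI)
    fix \<sigma> \<tau> assume st: "\<sigma> \<in> R" "\<tau> \<in> R" "\<sigma> \<noteq> \<tau>"
    have "\<not> (\<forall>v\<in>F. \<sigma> v = \<tau> v)"
    proof
      assume "\<forall>v\<in>F. \<sigma> v = \<tau> v"
      then have "\<sigma> = \<tau>"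
        using st(1,2) by (intro PiE_ext[of \<sigma> F "local_labelings E" \<tau>]) (simp_all add: R_def)
      then show False using st(3) by simp
    qed
    then show "cyl F \<sigma> \<inter> cyl F \<tau> = {}" unfolding cyl_def by auto
  qed
  have cover: "escape \<inter> A \<subseteq> (\<Union>\<sigma>\<in>R. escape \<inter> cyl F \<sigma>)"
  proof
    fix L assume L: "L \<in> escape \<inter> A"
    then have "restrict L F \<in> Pi\<^sub>E F (local_labelings E)"
      by (auto simp: escape_def labeling_def)
    moreover have "cyl F (restrict L F) \<subseteq> A"
    proof
      fix L' assume "L' \<in> cyl F (restrict L F)"
      then have "\<And>v. v \<in> F \<Longrightarrow> L v = L' v" by (simp add: cyl_def)
      then show "L' \<in> A" using det L by blast
    qed
    ultimately have "restrict L F \<in> R" by (simp add: R_def)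
    moreover have "L \<in> cyl F (restrict L F)" by (simp add: cyl_def)
    ultimately show "L \<in> (\<Union>\<sigma>\<in>R. escape \<inter> cyl F \<sigma>)" using L by blast
  qed
  have ev: "(\<lambda>\<sigma>. escape \<inter> cyl F \<sigma>) ` R \<subseteq> sets (random_labeling E)"
    using sets_escape sets_cyl[OF F] by auto
  have "?P (escape \<inter> A) \<le> ?P (\<Union>\<sigma>\<in>R. escape \<inter> cyl F \<sigma>)"
    by (rule labelings.finite_measure_mono[OF cover sets.finite_UN[OF finR]]) (use ev in blast)
  also have "\<dots> \<le> (\<Sum>\<sigma>\<in>R. ?P (escape \<inter> cyl F \<sigma>))"
    by (rule labelings.finite_measure_subadditive_finite[OF finR ev])
  also have "\<dots> \<le> (\<Sum>\<sigma>\<in>R. K * ?P (cyl F \<sigma>))" by (intro sum_mono atoms)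
  also have "\<dots> = K * ?P (\<Union>\<sigma>\<in>R. cyl F \<sigma>)"
    using labelings.finite_measure_finite_Union[OF finR _ disj] sets_cyl[OF F]
    by (simp add: sum_distrib_left image_subset_iff)
  also have "\<dots> \<le> K * ?P A"
    using K A by (intro mult_left_mono labelings.finite_measure_mono UN_least) (simp_all add: R_def)
  finally show ?thesis .
qed

text \<open>The worst case: \<open>2 * D + 3\<close> prescribed local labelings, each of probability
  at least \<open>1 / (D + 1) ^ D\<close>.\<close>

definition trap_prob :: real where
  "trap_prob = (1 / real ((D + 1) ^ D)) ^ (2 * D + 3)"

lemma trap_prob_bounds: "0 < trap_prob" "trap_prob \<le> 1"
proof -
  have "1 / real ((D + 1) ^ D) \<le> 1" by (simp add: field_simps)
  then show "trap_prob \<le> 1" unfolding trap_prob_def by (intro power_le_one) simp_all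
  show "0 < trap_prob" unfolding trap_prob_def by simp
qed

lemma trap_prob_le_cyl:
  assumes "labeling L" "finite W" "card W \<le> 2 * D + 3"
  shows "trap_prob \<le> measure (random_labeling E) (cyl W L)"
proof -
  let ?c = "1 / real ((D + 1) ^ D)"
  have "trap_prob \<le> ?c ^ card W"
    unfolding trap_prob_def using assms(3) by (intro power_decreasing) (simp_all add: field_simps)
  also have "\<dots> = (\<Prod>v\<in>W. ?c)" by simp
  also have "\<dots> \<le> (\<Prod>v\<in>W. pmf (port_pmf v) (L v))"
    using assms(1) by (intro prod_mono conjI pmf_port_pmf_ge) (simp_all add: labeling_def)
  also have "\<dots> = measure (random_labeling E) (cyl W L)" using prob_cyl[OF assms(2)] by simp
  finally show ?thesis .
qed

text \<open>Independence of the ports at disjoint sets of vertices; \<open>\<rho>\<close> glues the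
  two prescriptions into a single cylinder.\<close>

lemma prob_cyl_Diff:
  assumes "finite F" "finite W" "W \<inter> F = {}"
  shows "measure (random_labeling E) (cyl F \<sigma> - cyl W \<tau>)
    = measure (random_labeling E) (cyl F \<sigma>) * (1 - measure (random_labeling E) (cyl W \<tau>))"
proof -
  let ?P = "measure (random_labeling E)"
  define \<rho> where "\<rho> v = (if v \<in> W then \<tau> v else \<sigma> v)" for v
  have int: "cyl F \<sigma> \<inter> cyl W \<tau> = cyl (F \<union> W) \<rho>"
    using assms(3) unfolding cyl_def \<rho>_def by (auto; metis disjoint_iff)
  have "?P (cyl (F \<union> W) \<rho>) = (\<Prod>v\<in>F. pmf (port_pmf v) (\<rho> v)) * (\<Prod>v\<in>W. pmf (port_pmf v) (\<rho> v))"
    using assms by (subst prob_cyl) (auto intro!: prod.union_disjoint)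
  also have "(\<Prod>v\<in>F. pmf (port_pmf v) (\<rho> v)) = ?P (cyl F \<sigma>)"
    unfolding prob_cyl[OF assms(1)] using assms(3) by (intro prod.cong) (auto simp: \<rho>_def)
  also have "(\<Prod>v\<in>W. pmf (port_pmf v) (\<rho> v)) = ?P (cyl W \<tau>)"
    unfolding prob_cyl[OF assms(2)] by (intro prod.cong) (auto simp: \<rho>_def)
  finally have "?P (cyl F \<sigma> \<inter> cyl W \<tau>) = ?P (cyl F \<sigma>) * ?P (cyl W \<tau>)" by (simp add: int)
  moreover have "?P (cyl F \<sigma> - cyl W \<tau>) = ?P (cyl F \<sigma>) - ?P (cyl F \<sigma> \<inter> cyl W \<tau>)"
    using assms by (intro labelings.finite_measure_Diff') (simp_all add: sets_cyl)
  ultimately show ?thesis by (simp add: algebra_simps)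
qed

text \<open>Every finite configuration can be extended by a trap of probability at least
  \<open>trap_prob\<close>, so conditioning on finitely many ports never helps the walk to escape.\<close>

lemma escape_bound:
  "finite F \<Longrightarrow> measure (random_labeling E) (escape \<inter> cyl F \<sigma>)
    \<le> (1 - trap_prob) ^ n * measure (random_labeling E) (cyl F \<sigma>)"
proof (induction n arbitrary: F \<sigma>)
  case 0
  then show ?case by (simp add: labelings.finite_measure_mono sets_cyl)
next
  case (Suc n)
  let ?P = "measure (random_labeling E)" and ?q = "1 - trap_prob"
  \<comment> \<open>The trap avoids the closing, so the ports on all of \<open>G\<close> are fixed
    first; \<open>v0\<close> is included because \<open>trap_exists\<close> requires it.\<close>
  define G where "G = closing (insert v0 F)"
  have q: "0 \<le> ?q" using trap_prob_bounds by simp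
  have finG: "finite G" using Suc.prems finite_closing by (simp add: G_def)
  have FG: "F \<subseteq> G" using closing_superset[of "insert v0 F"] by (auto simp: G_def)
  have atoms: "?P (escape \<inter> cyl G \<tau>) \<le> ?q ^ Suc n * ?P (cyl G \<tau>)" for \<tau>
  proof (cases "\<exists>L0 \<in> cyl G \<tau>. labeling L0")
    case False
    then have "escape \<inter> cyl G \<tau> = {}" by (auto simp: escape_def)
    then show ?thesis using q by simp
  next
    case True
    then obtain L0 where L0: "labeling L0" "L0 \<in> cyl G \<tau>" by blast
    obtain W L1 where W: "finite W" "card W \<le> 2 * D + 3" "W \<inter> G = {}"
      and L1: "labeling L1" "\<forall>v\<in>G. L1 v = L0 v" "trapped (G \<union> W) L1"
      using trap_exists[of "insert v0 F" L0] Suc.prems L0(1) unfolding G_def by auto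
    have "walk_cycles E L v0 l" if "labeling L" "L \<in> cyl G \<tau>" "L \<in> cyl W L1" for L
    proof (rule trapped_cycles[OF L1(3,1) that(1)])
      fix v assume "v \<in> G \<union> W"
      then show "L v = L1 v" using that(2,3) L1(2) L0(2) by (auto simp: cyl_def)
    qed
    \<comment> \<open>Escaping means missing \<open>cyl W L1\<close>, which contributes one more
      factor. What remains is determined by the finite set \<open>G \<union> W\<close>, so the
      induction hypothesis applies atom by atom.\<close>
    then have "escape \<inter> cyl G \<tau> = escape \<inter> (cyl G \<tau> - cyl W L1)"
      by (auto simp: escape_def)
    also have "?P \<dots> \<le> ?q ^ n * ?P (cyl G \<tau> - cyl W L1)"
    proof (rule escape_bound_determined)
      show "finite (G \<union> W)" using finG W(1) by simp
      show "0 \<le> ?q ^ n" using q by simp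
      show "?P (escape \<inter> cyl (G \<union> W) \<sigma>) \<le> ?q ^ n * ?P (cyl (G \<union> W) \<sigma>)" for \<sigma>
        by (rule Suc.IH) (simp add: finG W(1))
      show "cyl G \<tau> - cyl W L1 \<in> sets (random_labeling E)"
        using finG W(1) by (intro sets.Diff sets_cyl)
      show "L' \<in> cyl G \<tau> - cyl W L1" if "\<And>v. v \<in> G \<union> W \<Longrightarrow> L v = L' v" "L \<in> cyl G \<tau> - cyl W L1" for L L'
        using that by (simp add: cyl_def)
    qed
    also have "\<dots> = ?q ^ n * (?P (cyl G \<tau>) * (1 - ?P (cyl W L1)))"
      using prob_cyl_Diff[OF finG W(1,3)] by simp
    also have "\<dots> \<le> ?q ^ n * (?P (cyl G \<tau>) * ?q)"
      using trap_prob_le_cyl[OF L1(1) W(1,2)] q by (intro mult_left_mono) simp_all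
    finally show ?thesis by (simp add: mult_ac)
  qed
  \<comment> \<open>As \<open>F \<subseteq> G\<close>, the event \<open>cyl F \<sigma>\<close> is
    determined by the ports on \<open>G\<close>, whose atoms have just been bounded.\<close>
  have "0 \<le> ?q ^ Suc n" using q by simp
  then show ?case
  proof (rule escape_bound_determined[OF finG _ atoms])
    show "cyl F \<sigma> \<in> sets (random_labeling E)" using Suc.prems by (rule sets_cyl)
    show "L' \<in> cyl F \<sigma>" if "\<And>v. v \<in> G \<Longrightarrow> L v = L' v" "L \<in> cyl F \<sigma>" for L L'
      using that FG by (force simp: cyl_def)
  qed
qed

text \<open>With \<open>F = {}\<close> nothing is conditioned on, and the bound holds for every
  \<open>n\<close>; it tends to \<open>0\<close> because \<open>trap_prob\<close> is
  positive.\<close>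

lemma prob_escape: "measure (random_labeling E) escape = 0"
proof -
  have "measure (random_labeling E) escape \<le> (1 - trap_prob) ^ n" for n
  proof -
    have "cyl {} \<sigma> = UNIV" for \<sigma> by (simp add: cyl_def)
    then show ?thesis
      using escape_bound[of "{}" _ n] labelings.prob_space by (simp add: space_random_labeling)
  qed
  moreover have "(\<lambda>n. (1 - trap_prob) ^ n) \<longlonglongrightarrow> 0"
    using trap_prob_bounds by (intro LIMSEQ_realpow_zero) simp_all
  ultimately have "measure (random_labeling E) escape \<le> 0"
    by (intro LIMSEQ_le_const[of _ 0]) auto
  then show ?thesis by (simp add: measure_le_0_iff)
qed

lemma prob_cycles: "measure (random_labeling E) {L. walk_cycles E L v0 l} = 1"
proof -
  have "AE L in random_labeling E. L \<notin> escape"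
    using prob_escape labelings.prob_eq_0[OF sets_escape] by blast
  with AE_labeling have "AE L in random_labeling E. L \<in> {L. walk_cycles E L v0 l}"
    by eventually_elim (auto simp: escape_def)
  then show ?thesis using labelings.AE_in_set_eq_1[OF sets_cycles] by blast
qed

end

theorem theorem4p7:
  fixes E :: "'a::countable \<Rightarrow> 'a \<Rightarrow> bool" and D :: nat and v0 :: 'a and l :: nat
  assumes sym: "\<And>v w. E v w \<Longrightarrow> E w v"
    and irrefl: "\<And>v. \<not> E v v"
    and infinite: "infinite (UNIV :: 'a set)"
    and connected: "\<And>v w. E\<^sup>*\<^sup>* v w"
    and fin_deg: "\<And>v. finite (nbrs E v)"
    and bdd_deg: "\<And>v. deg E v \<le> D"
    and port: "1 \<le> l" "l \<le> deg E v0"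
  shows "{L \<in> space (random_labeling E). walk_cycles E L v0 l} \<in> sets (random_labeling E)
     \<and> prob_space.prob (random_labeling E) {L \<in> space (random_labeling E). walk_cycles E L v0 l} = 1"
proof -
  interpret bounded_graph E D v0 l
    by unfold_locales (fact sym irrefl connected fin_deg bdd_deg port)+
  show ?thesis using sets_cycles prob_cycles by (simp add: space_random_labeling)
qed

end
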